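(* Let $\lambda,\mu\in\mathbb{R}$ and let $f:\mathbb{R}\to\mathbb{R}$ be given by $f(x)=\lfloor\lambda x+\mu\rfloor$. Then the number $N_c(\lambda,\mu)\in\{0,1,2,\ldots\}\cup\{\infty\}$ of $2$-cycles of $f$ is given by $$N_c(\lambda,\mu)=\begin{cases} \sum\limits_{k=1}^{\left\lceil\frac{1}{\lambda+1}\right\rceil-1}\max\left\{0,\left\lfloor\frac{k-\mu}{\lambda-1}\right\rfloor-\left\lfloor\frac{-\lambda k-\mu+1}{\lambda-1}\right\rfloor\right\},&\text{if }-1<\lambda<0;\\ \infty,&\text{if }\lambda=-1;\\ \sum\limits_{k=1}^{-\left\lfloor\frac{1}{\lambda+1}\right\rfloor-1}\max\left\{0,\left\lfloor\frac{-\lambda k-\mu}{\lambda-1}\right\rfloor-\left\lfloor\frac{k+1-\mu}{\lambda-1}\right\rfloor\right\},&\text{if }-2<\lambda<-1;\\ 0,&\text{if }\lambda\leqslant-2\text{ or }\lambda\geqslant0. \end{cases}$$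
   Context: $\lfloor\cdot\rfloor$ and $\lceil\cdot\rceil$ denote the floor and ceiling functions, and $f^2=f\circ f$. A $2$-cycle of $f$ is a set of the form $\{x,f(x)\}$ with $x\in\mathbb{R}$, $f(x)\neq x$ and $f^2(x)=x$; $N_c(\lambda,\mu)$ is the cardinality of the set of all such sets, written $\infty$ if infinite. *)

theory Defs
  imports Complex_Main "HOL-Library.Extended_Nat"
begin

definition floor_affine :: "real \<Rightarrow> real \<Rightarrow> real \<Rightarrow> real" where
  "floor_affine lam mu x = of_int \<lfloor>lam * x + mu\<rfloor>"

definition two_cycles :: "('a \<Rightarrow> 'a) \<Rightarrow> 'a set set" where
  "two_cycles f = {{x, f x} | x. f x \<noteq> x \<and> (f ^^ 2) x = x}"

definition ext_card :: "'a set \<Rightarrow> enat" where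
  "ext_card A = (if finite A then enat (card A) else \<infinity>)"

definition num_two_cycles :: "real \<Rightarrow> real \<Rightarrow> enat"  ("N\<^sub>c") where
  "N\<^sub>c lam mu = ext_card (two_cycles (floor_affine lam mu))"

end

theory Submission
  imports Defs
begin

text \<open>
  The points of a 2-cycle are integers, so a 2-cycle is \<open>{m, m + k}\<close> with \<open>k \<ge> 1\<close>, and the two
  conditions \<open>f m = m + k\<close>, \<open>f (m + k) = m\<close> say that \<open>(\<lambda> - 1) m\<close> lies in both half-open unit
  intervals starting at \<open>k - \<mu>\<close> and at \<open>-\<lambda> k - \<mu>\<close>. Which of the two starts first depends only on
  the sign of \<open>\<lambda> + 1\<close>, and they meet iff \<open>k \<bar>\<lambda> + 1\<bar> < 1\<close>. Dividing by \<open>\<lambda> - 1 < 0\<close>, one counts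
  integers \<open>m\<close> in a half-open interval for each of the finitely many admissible \<open>k\<close>.
\<close>

text \<open>Requiring \<open>1 \<le> k\<close> makes \<open>m\<close> the smaller point, so that
  each unordered cycle is counted once. The gap \<open>k\<close> comes first so that the set becomes
  a \<open>Sigma\<close> indexed by gaps.\<close>

definition cycle_pairs :: "real \<Rightarrow> real \<Rightarrow> (int \<times> int) set" where
  "cycle_pairs lam mu = {(k, m). 1 \<le> k \<and>
     \<lfloor>lam * of_int m + mu\<rfloor> = m + k \<and> \<lfloor>lam * of_int (m + k) + mu\<rfloor> = m}"

lemma ext_card_bij_betw:
  assumes "bij_betw f A B"
  shows "ext_card A = ext_card B"
  using bij_betw_finite[OF assms] bij_betw_same_card[OF assms] by (simp add: ext_card_def)

lemma bij_betw_cycle_pairs: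
  "bij_betw (\<lambda>(k, m). {of_int m, of_int (m + k)}) (cycle_pairs lam mu)
     (two_cycles (floor_affine lam mu))"
proof (rule bij_betw_imageI)
  show "inj_on (\<lambda>(k, m). {of_int m, of_int (m + k)} :: real set) (cycle_pairs lam mu)"
    \<comment> \<open>The crossed matching of two equal doubletons would force the sum of the two
      gaps to be zero, which positivity excludes.\<close>
    by (rule inj_onI) (auto simp: cycle_pairs_def doubleton_eq_iff simp flip: of_int_add)
  let ?f = "floor_affine lam mu"
  show "(\<lambda>(k, m). {of_int m, of_int (m + k)}) ` cycle_pairs lam mu = two_cycles ?f"
  proof (intro equalityI subsetI)
    fix c :: "real set"
    assume "c \<in> (\<lambda>(k, m). {of_int m, of_int (m + k)}) ` cycle_pairs lam mu"
    then obtain k m where c: "c = {of_int m, of_int (m + k)}" and km: "(k, m) \<in> cycle_pairs lam mu"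
      by auto
    have "?f (of_int m) = of_int (m + k)" "?f (of_int (m + k)) = of_int m" "k \<noteq> 0"
      using km unfolding floor_affine_def cycle_pairs_def by auto
    then have "c = {of_int m, ?f (of_int m)} \<and> ?f (of_int m) \<noteq> of_int m
        \<and> (?f ^^ 2) (of_int m) = of_int m"
      using c by (simp add: numeral_2_eq_2)
    then show "c \<in> two_cycles ?f"
      unfolding two_cycles_def by blast
  next
    fix c assume "c \<in> two_cycles ?f"
    then obtain x where c: "c = {x, ?f x}" and ne: "?f x \<noteq> x" and per: "?f (?f x) = x"
      by (auto simp: two_cycles_def numeral_2_eq_2)
    \<comment> \<open>Since \<open>x = ?f (?f x)\<close>, both points are values of
      \<open>?f\<close>, hence integers.\<close>
    obtain i j where i: "x = of_int i" and j: "?f x = of_int j"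
      using per by (metis floor_affine_def)
    have fl: "\<lfloor>lam * of_int i + mu\<rfloor> = j" "\<lfloor>lam * of_int j + mu\<rfloor> = i"
      using i j per by (simp_all add: floor_affine_def)
    show "c \<in> (\<lambda>(k, m). {of_int m, of_int (m + k)}) ` cycle_pairs lam mu"
    proof (cases "i < j")
      case True
      then have "(j - i, i) \<in> cycle_pairs lam mu" using fl by (simp add: cycle_pairs_def)
      then show ?thesis by (rule rev_image_eqI) (simp add: c i j[unfolded i])
    next
      case False
      then have "j < i" using ne i j by force
      then have "(i - j, j) \<in> cycle_pairs lam mu" using fl by (simp add: cycle_pairs_def)
      then show ?thesis by (rule rev_image_eqI) (simp add: c i j[unfolded i] insert_commute)
    qed
  qed
qed

lemma num_two_cycles_eq: "N\<^sub>c lam mu = ext_card (cycle_pairs lam mu)"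
  unfolding num_two_cycles_def using ext_card_bij_betw[OF bij_betw_cycle_pairs] by simp

lemma mem_cycle_pairs_iff:
  "(k, m) \<in> cycle_pairs lam mu \<longleftrightarrow> 1 \<le> k \<and>
     max (of_int k - mu) (- lam * of_int k - mu) \<le> (lam - 1) * of_int m \<and>
     (lam - 1) * of_int m < min (of_int k + 1 - mu) (- lam * of_int k - mu + 1)"
  by (auto simp: cycle_pairs_def floor_eq_iff algebra_simps)

text \<open>Dividing by \<open>a < 0\<close> swaps the ends: the closed bound \<open>u\<close>
  becomes a closed upper end and the strict bound \<open>v\<close> an open lower end. For integers
  both can be replaced by their floors.\<close>

lemma int_le_less_divide_neg_iff:
  fixes a u v :: real
  assumes "a < 0"
  shows "u \<le> a * of_int m \<and> a * of_int m < v \<longleftrightarrow> m \<in> {\<lfloor>v / a\<rfloor><..\<lfloor>u / a\<rfloor>}"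
  using assms by (auto simp: le_floor_iff floor_less_iff field_simps)

text \<open>Keeping \<open>u\<close> and \<open>v\<close> abstract lets one count serve both signs
  of \<open>lam + 1\<close>, where the maximum and the minimum resolve differently. The
  \<open>max 0\<close> accounts for gaps with an empty range of \<open>m\<close>.\<close>

lemma num_two_cycles_eq_sum:
  fixes lam mu :: real and u v :: "int \<Rightarrow> real" and K :: int
  assumes lam: "lam < 1"
    and u: "\<And>k. 1 \<le> k \<Longrightarrow> u k = max (of_int k - mu) (- lam * of_int k - mu)"
    and v: "\<And>k. 1 \<le> k \<Longrightarrow> v k = min (of_int k + 1 - mu) (- lam * of_int k - mu + 1)"
    and K: "\<And>k. 1 \<le> k \<Longrightarrow> u k < v k \<Longrightarrow> k \<le> K"
  shows "N\<^sub>c lam mu =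
    enat (nat (\<Sum>k = 1..K. max 0 (\<lfloor>u k / (lam - 1)\<rfloor> - \<lfloor>v k / (lam - 1)\<rfloor>)))"
proof -
  let ?S = "\<lambda>k. {\<lfloor>v k / (lam - 1)\<rfloor><..\<lfloor>u k / (lam - 1)\<rfloor>}"
  have "(k, m) \<in> cycle_pairs lam mu \<longleftrightarrow> k \<in> {1..K} \<and> m \<in> ?S k" for k m
  proof -
    have "(k, m) \<in> cycle_pairs lam mu \<longleftrightarrow>
        1 \<le> k \<and> u k \<le> (lam - 1) * of_int m \<and> (lam - 1) * of_int m < v k"
      unfolding mem_cycle_pairs_iff using u[of k] v[of k] by auto
    \<comment> \<open>Any admissible \<open>m\<close> forces \<open>u k < v k\<close>, hence
      \<open>k \<le> K\<close>.\<close>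
    also have "\<dots> \<longleftrightarrow> k \<in> {1..K} \<and> u k \<le> (lam - 1) * of_int m \<and> (lam - 1) * of_int m < v k"
      using K[of k] by auto
    finally show ?thesis
      using int_le_less_divide_neg_iff[of "lam - 1"] lam by simp
  qed
  then have eq: "cycle_pairs lam mu = Sigma {1..K} ?S" by auto
  have "int (card (cycle_pairs lam mu)) =
      (\<Sum>k = 1..K. max 0 (\<lfloor>u k / (lam - 1)\<rfloor> - \<lfloor>v k / (lam - 1)\<rfloor>))"
    unfolding eq by (auto simp: max_def intro!: sum.cong)
  moreover have "finite (cycle_pairs lam mu)" unfolding eq by simp
  ultimately show ?thesis by (metis num_two_cycles_eq ext_card_def nat_int)
qed

text \<open>The map is monotone here, so it cannot swap two distinct points.\<close>

lemma num_two_cycles_nonneg: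
  assumes "0 \<le> lam"
  shows "N\<^sub>c lam mu = 0"
proof -
  have False if "(k, m) \<in> cycle_pairs lam mu" for k m
  proof -
    have "lam * of_int m + mu \<le> lam * of_int (m + k) + mu"
      using that assms by (simp add: cycle_pairs_def mult_left_mono)
    then have "\<lfloor>lam * of_int m + mu\<rfloor> \<le> \<lfloor>lam * of_int (m + k) + mu\<rfloor>"
      by (rule floor_mono)
    then show False using that by (simp add: cycle_pairs_def)
  qed
  then have "cycle_pairs lam mu = {}" by auto
  then show ?thesis by (simp add: num_two_cycles_eq ext_card_def zero_enat_def)
qed

lemma num_two_cycles_minus_one: "N\<^sub>c (- 1) mu = \<infinity>"
proof -
  \<comment> \<open>For \<open>\<lambda> = -1\<close> both unit intervals coincide, so every \<open>m\<close> small enough has a partner.\<close>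
  let ?g = "\<lambda>m. (\<lfloor>mu\<rfloor> - 2 * m, m)"
  \<comment> \<open>The gap is forced by \<open>\<lfloor>mu - m\<rfloor> = m + k\<close>. The bound
    on \<open>m\<close> makes it at least \<open>- m\<close>, hence at least 1.\<close>
  have "(\<lfloor>mu\<rfloor> - 2 * m, m) \<in> cycle_pairs (- 1) mu" if "m \<le> min (-1) \<lfloor>mu\<rfloor>" for m
    using that by (auto simp: cycle_pairs_def floor_eq_iff)
  then have "?g ` {..min (-1) \<lfloor>mu\<rfloor>} \<subseteq> cycle_pairs (- 1) mu" by auto
  moreover have "infinite (?g ` {..min (-1) \<lfloor>mu\<rfloor>})"
    by (simp add: finite_image_iff inj_on_def infinite_Iic)
  ultimately have "infinite (cycle_pairs (- 1) mu)" using finite_subset by blast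
  then show ?thesis by (simp add: num_two_cycles_eq ext_card_def)
qed

theorem mainTheorem4:
  fixes lam mu :: real
  shows "N\<^sub>c lam mu =
    (if -1 < lam \<and> lam < 0 then
       enat (nat (\<Sum>k::int = 1..\<lceil>1 / (lam + 1)\<rceil> - 1.
         max 0 (\<lfloor>(of_int k - mu) / (lam - 1)\<rfloor>
                - \<lfloor>(- lam * of_int k - mu + 1) / (lam - 1)\<rfloor>)))
     else if lam = -1 then \<infinity>
     else if -2 < lam \<and> lam < -1 then
       enat (nat (\<Sum>k::int = 1..- \<lfloor>1 / (lam + 1)\<rfloor> - 1.
         max 0 (\<lfloor>(- lam * of_int k - mu) / (lam - 1)\<rfloor>
                - \<lfloor>(of_int k + 1 - mu) / (lam - 1)\<rfloor>)))
     else 0)"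
proof -
  consider "-1 < lam" "lam < 0" | "lam = -1" | "lam < -1" | "0 \<le> lam" by linarith
  then show ?thesis
  proof cases
    case 1
    have "N\<^sub>c lam mu = enat (nat (\<Sum>k = 1..\<lceil>1 / (lam + 1)\<rceil> - 1.
         max 0 (\<lfloor>(of_int k - mu) / (lam - 1)\<rfloor>
                - \<lfloor>(- lam * of_int k - mu + 1) / (lam - 1)\<rfloor>)))"
    proof (rule num_two_cycles_eq_sum)
      fix k :: int assume k: "1 \<le> k"
      have le: "- lam * of_int k \<le> of_int k"
        using 1 k mult_right_mono[of "- lam" 1 "of_int k"] by simp
      then show "of_int k - mu = max (of_int k - mu) (- lam * of_int k - mu)"
        and "- lam * of_int k - mu + 1 = min (of_int k + 1 - mu) (- lam * of_int k - mu + 1)"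
        by auto
      assume "of_int k - mu < - lam * of_int k - mu + 1"
      then have "of_int k < 1 / (lam + 1)" using 1 by (simp add: field_simps)
      \<comment> \<open>The inequality is strict, so the last gap is the ceiling minus one, also
        when \<open>1 / (lam + 1)\<close> is an integer.\<close>
      then show "k \<le> \<lceil>1 / (lam + 1)\<rceil> - 1" by linarith
    qed (use 1 in simp)
    then show ?thesis using 1 by simp
  next
    case 2
    then show ?thesis by (simp add: num_two_cycles_minus_one)
  next
    case 3
    have N: "N\<^sub>c lam mu = enat (nat (\<Sum>k = 1..- \<lfloor>1 / (lam + 1)\<rfloor> - 1.
         max 0 (\<lfloor>(- lam * of_int k - mu) / (lam - 1)\<rfloor>
                - \<lfloor>(of_int k + 1 - mu) / (lam - 1)\<rfloor>)))"
    proof (rule num_two_cycles_eq_sum)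
      fix k :: int assume k: "1 \<le> k"
      have le: "of_int k \<le> - lam * of_int k"
        using 3 k mult_right_mono[of 1 "- lam" "of_int k"] by simp
      then show "- lam * of_int k - mu = max (of_int k - mu) (- lam * of_int k - mu)"
        and "of_int k + 1 - mu = min (of_int k + 1 - mu) (- lam * of_int k - mu + 1)"
        by auto
      assume "- lam * of_int k - mu < of_int k + 1 - mu"
      \<comment> \<open>The assumption says \<open>- 1 < k * (lam + 1)\<close>; division by the
        negative \<open>lam + 1\<close> reverses it.\<close>
      then have "1 / (lam + 1) < of_int (- k)" using 3 by (simp add: field_simps)
      then show "k \<le> - \<lfloor>1 / (lam + 1)\<rfloor> - 1" by linarith
    qed (use 3 in simp)
    show ?thesis
    proof (cases "-2 < lam")
      case True
      then show ?thesis using N 3 by simp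
    next
      case False
      \<comment> \<open>The sum formula \<open>N\<close> holds for every \<open>lam < -1\<close>;
        for \<open>lam \<le> -2\<close> its index range is empty.\<close>
      then have "- 1 \<le> 1 / (lam + 1)" by (simp add: field_simps)
      then have "- \<lfloor>1 / (lam + 1)\<rfloor> - 1 < 1" by linarith
      then show ?thesis using N 3 False by (simp add: zero_enat_def)
    qed
  next
    case 4
    then show ?thesis by (simp add: num_two_cycles_nonneg)
  qed
qed

end
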